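(* Let $n=p_1\cdots p_k$ with $k\ge 1$ and $p_1,\dots,p_k$ distinct odd primes. Then the domination number of the undirected zero divisor graph $\overline{\Gamma}(\mathbb{Z}_n[i,j,k])$ is $k+p_1+\dots+p_k$.
   Context: $\mathbb{Z}_n[i,j,k]=\{a+bi+cj+dk: a,b,c,d\in\mathbb{Z}_n\}$ is the ring of Lipschitz quaternions modulo $n$, with $i^2=j^2=k^2=ijk=-1$ and coefficients in $\mathbb{Z}_n$ (integers modulo $n$) central (the quaternion unit $k$ is unrelated to the number $k$ of primes). For a ring $R$, an element $x$ is a zero divisor if there is a nonzero $y\in R$ with $xy=0$ or $yx=0$. The undirected zero divisor graph $\overline{\Gamma}(R)$ is the simple graph whose vertices are the nonzero zero divisors of $R$, with distinct $x,y$ adjacent iff $xy=0$ or $yx=0$. A dominating set of a graph $G$ is a set $D$ of vertices such that every vertex not in $D$ is adjacent to at least one member of $D$; the domination number is the minimum cardinality of a dominating set. *)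

theory Defs
  imports "HOL-Number_Theory.Residues" "Graph_Theory.Pair_Digraph"
begin

datatype 'a quaternion = Quat (re: 'a) (im_i: 'a) (im_j: 'a) (im_k: 'a)

text \<open>Quaternions with central coefficients in \<open>R\<close>: \<open>Quat a b c d\<close> stands for
  \<open>a + b i + c j + d k\<close>. The multiplication is the bilinear extension of
  \<open>i\<^sup>2 = j\<^sup>2 = k\<^sup>2 = ijk = -1\<close>.\<close>

definition quaternion_ring :: "('a, 'm) ring_scheme \<Rightarrow> 'a quaternion ring" where
  "quaternion_ring R =
    \<lparr> carrier = {Quat a b c d | a b c d.
        a \<in> carrier R \<and> b \<in> carrier R \<and> c \<in> carrier R \<and> d \<in> carrier R},
      monoid.mult = (\<lambda>x y. Quat
        (re x \<otimes>\<^bsub>R\<^esub> re y \<ominus>\<^bsub>R\<^esub> im_i x \<otimes>\<^bsub>R\<^esub> im_i y \<ominus>\<^bsub>R\<^esub> im_j x \<otimes>\<^bsub>R\<^esub> im_j y \<ominus>\<^bsub>R\<^esub> im_k x \<otimes>\<^bsub>R\<^esub> im_k y)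
        (re x \<otimes>\<^bsub>R\<^esub> im_i y \<oplus>\<^bsub>R\<^esub> im_i x \<otimes>\<^bsub>R\<^esub> re y \<oplus>\<^bsub>R\<^esub> im_j x \<otimes>\<^bsub>R\<^esub> im_k y \<ominus>\<^bsub>R\<^esub> im_k x \<otimes>\<^bsub>R\<^esub> im_j y)
        (re x \<otimes>\<^bsub>R\<^esub> im_j y \<oplus>\<^bsub>R\<^esub> im_j x \<otimes>\<^bsub>R\<^esub> re y \<oplus>\<^bsub>R\<^esub> im_k x \<otimes>\<^bsub>R\<^esub> im_i y \<ominus>\<^bsub>R\<^esub> im_i x \<otimes>\<^bsub>R\<^esub> im_k y)
        (re x \<otimes>\<^bsub>R\<^esub> im_k y \<oplus>\<^bsub>R\<^esub> im_k x \<otimes>\<^bsub>R\<^esub> re y \<oplus>\<^bsub>R\<^esub> im_i x \<otimes>\<^bsub>R\<^esub> im_j y \<ominus>\<^bsub>R\<^esub> im_j x \<otimes>\<^bsub>R\<^esub> im_i y)),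
      one = Quat \<one>\<^bsub>R\<^esub> \<zero>\<^bsub>R\<^esub> \<zero>\<^bsub>R\<^esub> \<zero>\<^bsub>R\<^esub>,
      zero = Quat \<zero>\<^bsub>R\<^esub> \<zero>\<^bsub>R\<^esub> \<zero>\<^bsub>R\<^esub> \<zero>\<^bsub>R\<^esub>,
      add = (\<lambda>x y. Quat (re x \<oplus>\<^bsub>R\<^esub> re y) (im_i x \<oplus>\<^bsub>R\<^esub> im_i y)
        (im_j x \<oplus>\<^bsub>R\<^esub> im_j y) (im_k x \<oplus>\<^bsub>R\<^esub> im_k y)) \<rparr>"

definition lipschitz_quaternions_mod :: "nat \<Rightarrow> int quaternion ring" where
  "lipschitz_quaternions_mod n = quaternion_ring (residue_ring (int n))"

lemma (in cring) quaternion_ring_is_ring: "ring (quaternion_ring R)"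
proof (intro ringI abelian_groupI monoidI)
  fix x assume "x \<in> carrier (quaternion_ring R)"
  then obtain a b c d where "x = Quat a b c d" "a \<in> carrier R" "b \<in> carrier R"
      "c \<in> carrier R" "d \<in> carrier R"
    by (auto simp: quaternion_ring_def)
  then show "\<exists>y\<in>carrier (quaternion_ring R).
      y \<oplus>\<^bsub>quaternion_ring R\<^esub> x = \<zero>\<^bsub>quaternion_ring R\<^esub>"
    by (intro bexI[of _ "Quat (\<ominus> a) (\<ominus> b) (\<ominus> c) (\<ominus> d)"])
      (auto simp: quaternion_ring_def l_neg)
qed (auto simp: quaternion_ring_def a_minus_def l_distr r_distr minus_add l_minus r_minus
      m_assoc a_ac)

lemma (in cring) quaternion_relations:
  defines "H \<equiv> quaternion_ring R"
    and "i \<equiv> Quat \<zero> \<one> \<zero> \<zero>" and "j \<equiv> Quat \<zero> \<zero> \<one> \<zero>" and "k \<equiv> Quat \<zero> \<zero> \<zero> \<one>"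
  shows "i \<otimes>\<^bsub>H\<^esub> i = Quat (\<ominus> \<one>) \<zero> \<zero> \<zero>" "j \<otimes>\<^bsub>H\<^esub> j = Quat (\<ominus> \<one>) \<zero> \<zero> \<zero>"
    "k \<otimes>\<^bsub>H\<^esub> k = Quat (\<ominus> \<one>) \<zero> \<zero> \<zero>" "i \<otimes>\<^bsub>H\<^esub> j \<otimes>\<^bsub>H\<^esub> k = Quat (\<ominus> \<one>) \<zero> \<zero> \<zero>"
  by (simp_all add: assms quaternion_ring_def a_minus_def)

definition zero_divisor :: "('a, 'm) ring_scheme \<Rightarrow> 'a \<Rightarrow> bool" where
  "zero_divisor R x \<longleftrightarrow> x \<in> carrier R \<and>
    (\<exists>y \<in> carrier R. y \<noteq> \<zero>\<^bsub>R\<^esub> \<and> (x \<otimes>\<^bsub>R\<^esub> y = \<zero>\<^bsub>R\<^esub> \<or> y \<otimes>\<^bsub>R\<^esub> x = \<zero>\<^bsub>R\<^esub>))"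

text \<open>A simple graph is represented by the symmetric loop-free digraph with an arc in both
  directions for each edge.\<close>

definition undirected_zero_divisor_graph :: "('a, 'm) ring_scheme \<Rightarrow> 'a pair_pre_digraph" where
  "undirected_zero_divisor_graph R =
    (let V = {x. zero_divisor R x \<and> x \<noteq> \<zero>\<^bsub>R\<^esub>} in
     \<lparr> pverts = V,
       parcs = {(x, y). x \<in> V \<and> y \<in> V \<and> x \<noteq> y \<and>
         (x \<otimes>\<^bsub>R\<^esub> y = \<zero>\<^bsub>R\<^esub> \<or> y \<otimes>\<^bsub>R\<^esub> x = \<zero>\<^bsub>R\<^esub>)} \<rparr>)"

lemma pair_bidirected_undirected_zero_divisor_graph:
  "pair_bidirected_digraph (undirected_zero_divisor_graph R)"
  by unfold_locales
    (auto simp: undirected_zero_divisor_graph_def Let_def symmetric_def sym_def)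

definition dominating_set :: "'a pair_pre_digraph \<Rightarrow> 'a set \<Rightarrow> bool" where
  "dominating_set G D \<longleftrightarrow> D \<subseteq> pverts G \<and>
    (\<forall>v \<in> pverts G - D. \<exists>d \<in> D. (v, d) \<in> parcs G)"

text \<open>Meaningful when \<open>G\<close> has a finite dominating set, in particular when \<open>G\<close> is finite; the
  conjunct \<open>finite D\<close> excludes infinite sets, whose \<open>card\<close> is \<open>0\<close>.\<close>

definition domination_number :: "'a pair_pre_digraph \<Rightarrow> nat" where
  "domination_number G = (LEAST m. \<exists>D. dominating_set G D \<and> finite D \<and> card D = m)"

lemma finite_lipschitz_quaternions_mod: "finite (carrier (lipschitz_quaternions_mod n))"
proof -
  have "carrier (lipschitz_quaternions_mod n) \<subseteq>
      (\<lambda>(a, b, c, d). Quat a b c d) ` ({0..int n - 1} \<times> {0..int n - 1} \<times> {0..int n - 1} \<times> {0..int n - 1})"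
    by (force simp: lipschitz_quaternions_mod_def quaternion_ring_def residue_ring_def)
  then show ?thesis
    by (rule finite_subset) simp
qed

end

theory Submission
  imports Defs
begin

text \<open>
  By the Chinese remainder theorem and because \<open>-1\<close> is a sum of two squares modulo every odd
  prime, the ring is the product of the matrix rings \<open>M\<^sub>2(F\<^sub>p)\<close> over the primes
  \<open>p\<close> dividing \<open>n\<close> (\<open>lipschitz_quaternions_split\<close>). In each factor, the matrices that
  are neither zero nor invertible are those of rank one, and such a matrix is, up to a scalar, a pair
  (image, kernel) of two of the \<open>p + 1\<close> lines of the plane. A product \<open>xy\<close> of two of them vanishes
  iff the image of \<open>y\<close> is the kernel of \<open>x\<close>.

  Upper bound: for every prime \<open>p\<close> and every line \<open>L\<close> take the element whose component at \<open>p\<close> has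
  image and kernel \<open>L\<close> and whose other components are zero. A zero divisor \<open>v\<close> is singular at some
  prime; there it kills some line or has its image inside some line, so one of these elements
  annihilates it. This gives \<open>p + 1\<close> vertices for each \<open>p\<close>.

  Lower bound: fix \<open>p\<close> and look at the elements that have rank one at \<open>p\<close> and are \<open>1\<close> at every other
  prime. Whatever annihilates one of them is supported at \<open>p\<close> only, so different primes
  use disjoint parts of a dominating set \<open>D\<close>, and it suffices that the part \<open>F\<close> for \<open>p\<close>,
  consisting of such annihilators and of the chosen elements that lie in \<open>D\<close> themselves, has more
  than \<open>p\<close> elements. A nonzero matrix has at most one kernel line and at most one image
  line. If \<open>F\<close> had at most \<open>p\<close> elements, some line \<open>s\<close> would not be a kernel and some line \<open>t\<close> would
  not be an image of a member of \<open>F\<close>. The \<open>p - 1\<close> multiples of the matrix with image \<open>s\<close> and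
  kernel \<open>t\<close> are then undominated, so they all lie in \<open>F\<close>. They share their kernel, so \<open>F\<close>
  leaves even \<open>p - 1 \<ge> 2\<close> lines unused as kernels, and a second choice of \<open>s\<close> puts
  \<open>2 (p - 1) > p\<close> elements into \<open>F\<close>. This is where \<open>p\<close> has to be odd.
\<close>

section \<open>Counting dominators by kernel and image\<close>

text \<open>
  The combinatorial core of the lower bound. Here \<open>K d\<close> and \<open>J d\<close> stand for the kernel line and
  the image line of \<open>d\<close>, if any, among \<open>q + 1\<close> lines, and \<open>X c s t\<close> for \<open>c\<close> times a fixed matrix
  with image \<open>s\<close> and kernel \<open>t\<close>. The scalars matter: a single undominated
  vertex could simply be put into \<open>F\<close>, but \<open>q - 1\<close> vertices with the same kernel waste too many
  members of \<open>F\<close>.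
\<close>

lemma dominators_card_gt:
  fixes q :: nat and F :: "'a set" and K J :: "'a \<Rightarrow> nat set" and X :: "nat \<Rightarrow> nat \<Rightarrow> nat \<Rightarrow> 'a"
  assumes fin: "finite F" and q: "3 \<le> q"
    and K: "\<And>d s t. d \<in> F \<Longrightarrow> s \<in> K d \<Longrightarrow> t \<in> K d \<Longrightarrow> s = t"
    and J: "\<And>d s t. d \<in> F \<Longrightarrow> s \<in> J d \<Longrightarrow> t \<in> J d \<Longrightarrow> s = t"
    and inj: "\<And>c s t c' s' t'. \<lbrakk>c \<in> {1..<q}; s \<le> q; t \<le> q; c' \<in> {1..<q}; s' \<le> q; t' \<le> q;
      X c s t = X c' s' t'\<rbrakk> \<Longrightarrow> c = c' \<and> s = s'"
    and KX: "\<And>c s t. \<lbrakk>c \<in> {1..<q}; s \<le> q; t \<le> q\<rbrakk> \<Longrightarrow> t \<in> K (X c s t)"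
    and dom: "\<And>c s t. \<lbrakk>c \<in> {1..<q}; s \<le> q; t \<le> q\<rbrakk> \<Longrightarrow>
      X c s t \<in> F \<or> (\<exists>d\<in>F. s \<in> K d \<or> t \<in> J d)"
  shows "q < card F"
proof (rule ccontr)
  assume "\<not> q < card F"
  then have small: "card F \<le> q" by simp
  have card_UN: "finite (\<Union>(L ` G)) \<and> card (\<Union>(L ` G)) \<le> card G"
    if "G \<subseteq> F" and L: "\<And>d s t. d \<in> F \<Longrightarrow> s \<in> L d \<Longrightarrow> t \<in> L d \<Longrightarrow> s = t"
    for G and L :: "'a \<Rightarrow> nat set"
  proof -
    have fG: "finite G" using that(1) fin by (rule finite_subset)
    have 1: "finite (L d) \<and> card (L d) \<le> 1" if "d \<in> G" for d
    proof (cases "L d = {}")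
      case False
      then obtain t where "t \<in> L d" by blast
      then have "L d = {t}" using L \<open>d \<in> G\<close> \<open>G \<subseteq> F\<close> by blast
      then show ?thesis by simp
    qed simp
    have "card (\<Union>(L ` G)) \<le> (\<Sum>d\<in>G. card (L d))" by (rule card_UN_le[OF fG])
    also have "\<dots> \<le> (\<Sum>d\<in>G. 1)" using 1 by (intro sum_mono) auto
    finally show ?thesis using 1 fG by auto
  qed
  have missed: "card ({..q} - U) \<ge> q + 1 - card U" if "finite U" for U
    using diff_card_le_card_Diff[OF that, of "{..q}"] by simp
  let ?A = "{..q} - \<Union>(K ` F)" and ?B = "{..q} - \<Union>(J ` F)"
  have "card ?A > 0" "card ?B > 0"
    using missed[of "\<Union>(K ` F)"] missed[of "\<Union>(J ` F)"] small
      card_UN[of F K] card_UN[of F J] K J by fastforce+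
  then obtain s t where s: "s \<in> ?A" and t: "t \<in> ?B"
    by (metis card_gt_0_iff ex_in_conv)
  \<comment> \<open>The vertices with image \<open>u\<close> and kernel \<open>t\<close>: nothing in \<open>F\<close> dominates them if \<open>u\<close> is missed.\<close>
  define S where "S u = (\<lambda>c. X c u t) ` {1..<q}" for u
  have S_sub: "S u \<subseteq> F" if "u \<in> ?A" for u
    using dom that t unfolding S_def by fastforce
  have S_card: "card (S u) = q - 1" if "u \<in> ?A" for u
  proof -
    have "inj_on (\<lambda>c. X c u t) {1..<q}"
      using inj that t by (intro inj_onI) auto
    then show ?thesis unfolding S_def by (simp add: card_image)
  qed
  \<comment> \<open>All of \<open>S s\<close> contributes the single kernel \<open>t\<close>, so \<open>F\<close> has at most two kernels.\<close>
  have "\<Union>(K ` F) \<subseteq> insert t (\<Union>(K ` (F - S s)))"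
  proof
    fix u assume "u \<in> \<Union>(K ` F)"
    then obtain d where d: "d \<in> F" "u \<in> K d" by blast
    show "u \<in> insert t (\<Union>(K ` (F - S s)))"
    proof (cases "d \<in> S s")
      case True
      then have "t \<in> K d" using KX s t unfolding S_def by auto
      then show ?thesis using K d by blast
    qed (use d in blast)
  qed
  moreover have fin': "finite (\<Union>(K ` (F - S s)))" and "card (\<Union>(K ` (F - S s))) \<le> card (F - S s)"
    using card_UN[of "F - S s" K] K by auto
  ultimately have "card (\<Union>(K ` F)) \<le> Suc (card (F - S s))"
    using card_mono[of "insert t (\<Union>(K ` (F - S s)))" "\<Union>(K ` F)"]
    by (auto simp: card_insert_if split: if_splits)
  also have "card (F - S s) = card F - (q - 1)"
    using S_sub[OF s] S_card[OF s] by (metis card_Diff_subset fin finite_subset)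
  finally have "card ?A \<ge> 2"
    using missed[of "\<Union>(K ` F)"] card_UN[of F K] K small q by fastforce
  then have "\<not> card ?A \<le> Suc 0" by linarith
  then obtain s' where s': "s' \<in> ?A" "s' \<noteq> s"
    using card_le_Suc0_iff_eq[of ?A] s by (metis finite_Diff finite_atMost)
  have "S s \<inter> S s' = {}"
    using inj s s' t unfolding S_def by fastforce
  then have "card (S s \<union> S s') = 2 * (q - 1)"
    using S_card[OF s] S_card[OF s'(1)] q by (subst card_Un_disjoint) (auto simp: S_def)
  moreover have "card (S s \<union> S s') \<le> card F"
    using S_sub[OF s] S_sub[OF s'(1)] fin by (intro card_mono) auto
  ultimately show False using small q by linarith
qed

section \<open>Two by two matrices modulo a prime\<close>

datatype mat2 = Mat2 (m11: int) (m12: int) (m21: int) (m22: int)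

definition mat2_mult :: "mat2 \<Rightarrow> mat2 \<Rightarrow> mat2" where
  "mat2_mult A B = Mat2 (m11 A * m11 B + m12 A * m21 B) (m11 A * m12 B + m12 A * m22 B)
     (m21 A * m11 B + m22 A * m21 B) (m21 A * m12 B + m22 A * m22 B)"

definition mat2_cong :: "nat \<Rightarrow> mat2 \<Rightarrow> mat2 \<Rightarrow> bool" where
  "mat2_cong q A B \<longleftrightarrow> [m11 A = m11 B] (mod int q) \<and> [m12 A = m12 B] (mod int q) \<and>
     [m21 A = m21 B] (mod int q) \<and> [m22 A = m22 B] (mod int q)"

definition mat2_null :: "nat \<Rightarrow> mat2 \<Rightarrow> bool" where
  "mat2_null q A \<longleftrightarrow> int q dvd m11 A \<and> int q dvd m12 A \<and> int q dvd m21 A \<and> int q dvd m22 A"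

text \<open>
  The lines of the plane over \<open>F\<^sub>q\<close> are numbered by \<open>{..q}\<close>: line \<open>t < q\<close> is spanned by \<open>(1, t)\<close> and
  line \<open>q\<close>, the point at infinity, by \<open>(0, 1)\<close>.
\<close>

definition pt_x :: "nat \<Rightarrow> nat \<Rightarrow> int" where
  "pt_x q t = (if t < q then 1 else 0)"

definition pt_y :: "nat \<Rightarrow> nat \<Rightarrow> int" where
  "pt_y q t = (if t < q then int t else 1)"

definition kernel_at :: "nat \<Rightarrow> mat2 \<Rightarrow> nat \<Rightarrow> bool" where
  "kernel_at q A t \<longleftrightarrow> int q dvd m11 A * pt_x q t + m12 A * pt_y q t \<and>
     int q dvd m21 A * pt_x q t + m22 A * pt_y q t"

text \<open>
  The image of \<open>A\<close> lies in the line spanned by \<open>(x, y)\<close> iff the covector \<open>(-y, x)\<close>, which cuts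
  out that line, annihilates the columns of \<open>A\<close>.
\<close>

definition image_at :: "nat \<Rightarrow> mat2 \<Rightarrow> nat \<Rightarrow> bool" where
  "image_at q A t \<longleftrightarrow> int q dvd m21 A * pt_x q t - m11 A * pt_y q t \<and>
     int q dvd m22 A * pt_x q t - m12 A * pt_y q t"

text \<open>
  The matrix \<open>c v w\<close> with the column \<open>v\<close> spanning line \<open>s\<close> and the row \<open>w\<close> annihilating line \<open>t\<close>: if
  \<open>c\<close> is a unit, its image is \<open>s\<close> and its kernel is \<open>t\<close>.
\<close>

definition rank_one :: "nat \<Rightarrow> nat \<Rightarrow> nat \<Rightarrow> nat \<Rightarrow> mat2" where
  "rank_one q c s t = Mat2
     (- (int c * pt_x q s * pt_y q t)) (int c * pt_x q s * pt_x q t)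
     (- (int c * pt_y q s * pt_y q t)) (int c * pt_y q s * pt_x q t)"

abbreviation mat2_one :: mat2 where
  "mat2_one \<equiv> Mat2 1 0 0 1"

abbreviation mat2_zero :: mat2 where
  "mat2_zero \<equiv> Mat2 0 0 0 0"

lemma mat2_cong_refl: "mat2_cong q A A"
  by (simp add: mat2_cong_def)

lemma mat2_cong_sym: "mat2_cong q A B \<Longrightarrow> mat2_cong q B A"
  by (auto simp: mat2_cong_def cong_sym)

lemma mat2_cong_trans: "mat2_cong q A B \<Longrightarrow> mat2_cong q B C \<Longrightarrow> mat2_cong q A C"
  unfolding mat2_cong_def by (blast intro: cong_trans)

lemma mat2_cong_mult:
  "mat2_cong q A A' \<Longrightarrow> mat2_cong q B B' \<Longrightarrow> mat2_cong q (mat2_mult A B) (mat2_mult A' B')"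
  unfolding mat2_cong_def mat2_mult_def by (auto intro!: cong_add cong_mult)

lemma mat2_null_cong: "mat2_cong q A B \<Longrightarrow> mat2_null q A \<longleftrightarrow> mat2_null q B"
  unfolding mat2_cong_def mat2_null_def by (auto dest: cong_dvd_iff)

lemma kernel_at_cong:
  assumes "mat2_cong q A B" shows "kernel_at q A t \<longleftrightarrow> kernel_at q B t"
proof -
  have "[m11 A * pt_x q t + m12 A * pt_y q t = m11 B * pt_x q t + m12 B * pt_y q t] (mod int q)"
    "[m21 A * pt_x q t + m22 A * pt_y q t = m21 B * pt_x q t + m22 B * pt_y q t] (mod int q)"
    using assms unfolding mat2_cong_def by (auto intro!: cong_add cong_mult)
  then show ?thesis unfolding kernel_at_def by (metis cong_dvd_iff)
qed

lemma image_at_cong: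
  assumes "mat2_cong q A B" shows "image_at q A t \<longleftrightarrow> image_at q B t"
proof -
  have "[m21 A * pt_x q t - m11 A * pt_y q t = m21 B * pt_x q t - m11 B * pt_y q t] (mod int q)"
    "[m22 A * pt_x q t - m12 A * pt_y q t = m22 B * pt_x q t - m12 B * pt_y q t] (mod int q)"
    using assms unfolding mat2_cong_def by (auto intro!: cong_diff cong_mult)
  then show ?thesis unfolding image_at_def by (metis cong_dvd_iff)
qed

lemma mat2_null_mult: "mat2_null q A \<or> mat2_null q B \<Longrightarrow> mat2_null q (mat2_mult A B)"
  unfolding mat2_null_def mat2_mult_def by auto

lemma mat2_null_mult_one:
  "mat2_null q (mat2_mult mat2_one A) \<longleftrightarrow> mat2_null q A"
  "mat2_null q (mat2_mult A mat2_one) \<longleftrightarrow> mat2_null q A"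
  unfolding mat2_null_def mat2_mult_def by auto

context
  fixes q :: nat
  assumes q: "prime q"
begin

lemma prime_int_q: "prime (int q)"
  using q by simp

lemma q_not_dvd_one: "\<not> int q dvd 1"
  using prime_int_q by (metis not_prime_unit)

lemma pt_det_dvd_iff:
  assumes "s \<le> q" "t \<le> q"
  shows "int q dvd pt_x q s * pt_y q t - pt_y q s * pt_x q t \<longleftrightarrow> s = t"
proof -
  have "s = t" if "int q dvd int t - int s" "s < q" "t < q"
  proof -
    have "[int t = int s] (mod int q)" using that(1) by (simp add: cong_iff_dvd_diff)
    then show ?thesis using that(2,3) by (simp add: cong_int_iff cong_def)
  qed
  then show ?thesis
    using assms q_not_dvd_one unfolding pt_x_def pt_y_def by auto
qed

lemma covector_zero_if_two_points:
  assumes "s \<le> q" "t \<le> q" "s \<noteq> t"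
    and 1: "int q dvd u * pt_x q s + v * pt_y q s" and 2: "int q dvd u * pt_x q t + v * pt_y q t"
  shows "int q dvd u \<and> int q dvd v"
proof -
  let ?d = "pt_x q s * pt_y q t - pt_y q s * pt_x q t"
  have "u * ?d = (u * pt_x q s + v * pt_y q s) * pt_y q t - (u * pt_x q t + v * pt_y q t) * pt_y q s"
    "v * ?d = (u * pt_x q t + v * pt_y q t) * pt_x q s - (u * pt_x q s + v * pt_y q s) * pt_x q t"
    by (simp_all add: algebra_simps)
  then have "int q dvd u * ?d" "int q dvd v * ?d"
    using 1 2 by (metis dvd_diff dvd_mult2)+
  then show ?thesis
    using pt_det_dvd_iff[OF assms(1,2)] assms(3) prime_int_q by (metis prime_dvd_mult_iff)
qed

text \<open>
  Every nonzero vector spans one of the numbered lines. Proportionality is phrased through the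
  covectors that annihilate the vector, which is the form in which it is applied to the rows of a
  matrix.
\<close>

lemma ex_point_proportional:
  assumes "\<not> (int q dvd a \<and> int q dvd b)"
  shows "\<exists>t\<le>q. \<forall>u v. int q dvd u * a + v * b \<longrightarrow> int q dvd u * pt_x q t + v * pt_y q t"
proof (cases "int q dvd a")
  case True
  then have b: "\<not> int q dvd b" using assms by simp
  have "int q dvd u * pt_x q q + v * pt_y q q" if "int q dvd u * a + v * b" for u v
  proof -
    have "int q dvd v * b" using that True by (metis dvd_add_right_iff dvd_mult)
    then have "int q dvd v" using b prime_int_q by (metis prime_dvd_mult_iff)
    then show ?thesis by (simp add: pt_x_def pt_y_def)
  qed
  then show ?thesis by blast
next
  case False
  then have "coprime a (int q)"
    using prime_int_q by (metis coprime_commute prime_imp_coprime)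
  then obtain a' where a': "[a * a' = 1] (mod int q)" by (metis cong_solve_coprime_int)
  \<comment> \<open>The slope \<open>b / a\<close>.\<close>
  define t where "t = nat ((b * a') mod int q)"
  have q0: "int q > 0" using q prime_gt_0_nat by simp
  have t: "t < q" unfolding t_def using q0 by (simp add: nat_less_iff)
  have "[int t = b * a'] (mod int q)" unfolding t_def using q0 by simp
  then have "[a * int t = a * (b * a')] (mod int q)" by (rule cong_scalar_left)
  also have "a * (b * a') = b * (a * a')" by simp
  also have "[b * (a * a') = b * 1] (mod int q)" by (rule cong_scalar_left[OF a'])
  finally have at: "[a * int t = b] (mod int q)" by simp
  have "int q dvd u * pt_x q t + v * pt_y q t" if "int q dvd u * a + v * b" for u v
  proof -
    have "[u * a + v * (a * int t) = u * a + v * b] (mod int q)"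
      using at by (intro cong_add cong_mult cong_refl)
    then have "int q dvd u * a + v * (a * int t)" using that by (metis cong_dvd_iff)
    also have "u * a + v * (a * int t) = a * (u + v * int t)" by (simp add: algebra_simps)
    finally have "int q dvd u + v * int t"
      using False prime_int_q by (metis prime_dvd_mult_iff)
    then show ?thesis using t by (simp add: pt_x_def pt_y_def)
  qed
  then show ?thesis using t less_imp_le by blast
qed

lemma ex_kernel_point:
  assumes "mat2_null q (mat2_mult A B)" "\<not> mat2_null q B"
  shows "\<exists>t\<le>q. kernel_at q A t"
proof -
  obtain x y where nz: "\<not> (int q dvd x \<and> int q dvd y)"
    and "int q dvd m11 A * x + m12 A * y" "int q dvd m21 A * x + m22 A * y"
    using assms unfolding mat2_null_def mat2_mult_def by auto
  then show ?thesis
    using ex_point_proportional[OF nz] unfolding kernel_at_def by blast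
qed

text \<open>
  A nonzero row \<open>(x, y)\<close> of \<open>A\<close> annihilates the columns of \<open>B\<close>, so these are proportional to
  \<open>(y, -x)\<close>.
\<close>

lemma ex_image_point:
  assumes "mat2_null q (mat2_mult A B)" "\<not> mat2_null q A"
  shows "\<exists>t\<le>q. image_at q B t"
proof -
  obtain x y where nz: "\<not> (int q dvd x \<and> int q dvd y)"
    and 1: "int q dvd x * m11 B + y * m21 B" "int q dvd x * m12 B + y * m22 B"
    using assms unfolding mat2_null_def mat2_mult_def by auto
  have nz': "\<not> (int q dvd y \<and> int q dvd - x)" using nz by auto
  have "int q dvd m21 B * y + (- m11 B) * (- x)" "int q dvd m22 B * y + (- m12 B) * (- x)"
    using 1 by (simp_all add: algebra_simps)
  then obtain t where "t \<le> q" "int q dvd m21 B * pt_x q t + (- m11 B) * pt_y q t"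
      "int q dvd m22 B * pt_x q t + (- m12 B) * pt_y q t"
    using ex_point_proportional[OF nz'] by blast
  then show ?thesis unfolding image_at_def by auto
qed

lemma kernel_point_unique:
  assumes "\<not> mat2_null q A" "s \<le> q" "t \<le> q" "kernel_at q A s" "kernel_at q A t"
  shows "s = t"
proof (rule ccontr)
  assume "s \<noteq> t"
  note zero = covector_zero_if_two_points[OF assms(2,3) this]
  have "int q dvd m11 A \<and> int q dvd m12 A" "int q dvd m21 A \<and> int q dvd m22 A"
    by (rule zero; use assms(4,5) in \<open>simp add: kernel_at_def\<close>)+
  then show False using assms(1) unfolding mat2_null_def by simp
qed

lemma image_point_unique:
  assumes "\<not> mat2_null q A" "s \<le> q" "t \<le> q" "image_at q A s" "image_at q A t"
  shows "s = t"
proof (rule ccontr)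
  assume "s \<noteq> t"
  note zero = covector_zero_if_two_points[OF assms(2,3) this]
  have "int q dvd m21 A \<and> int q dvd - m11 A" "int q dvd m22 A \<and> int q dvd - m12 A"
    by (rule zero; use assms(4,5) in \<open>simp add: image_at_def\<close>)+
  then show False using assms(1) unfolding mat2_null_def by simp
qed

lemma dvd_pt_mult_iff:
  "int q dvd pt_x q s * z \<and> int q dvd pt_y q s * z \<longleftrightarrow> int q dvd z"
  by (auto simp: pt_x_def pt_y_def)

lemma mult_rank_one_null_iff:
  assumes "\<not> q dvd c"
  shows "mat2_null q (mat2_mult A (rank_one q c s t)) \<longleftrightarrow> kernel_at q A s"
proof -
  let ?u = "m11 A * pt_x q s + m12 A * pt_y q s" and ?v = "m21 A * pt_x q s + m22 A * pt_y q s"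
  have "mat2_mult A (rank_one q c s t) = Mat2 (- (int c * (pt_y q t * ?u))) (int c * (pt_x q t * ?u))
     (- (int c * (pt_y q t * ?v))) (int c * (pt_x q t * ?v))"
    unfolding mat2_mult_def rank_one_def by (simp add: algebra_simps)
  moreover have "int q dvd int c * z \<longleftrightarrow> int q dvd z" for z
    using assms prime_int_q by (simp add: prime_dvd_mult_iff)
  ultimately show ?thesis
    unfolding mat2_null_def kernel_at_def using dvd_pt_mult_iff[of t] by auto
qed

lemma rank_one_mult_null_iff:
  assumes "\<not> q dvd c"
  shows "mat2_null q (mat2_mult (rank_one q c s t) A) \<longleftrightarrow> image_at q A t"
proof -
  let ?u = "m21 A * pt_x q t - m11 A * pt_y q t" and ?v = "m22 A * pt_x q t - m12 A * pt_y q t"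
  have "mat2_mult (rank_one q c s t) A = Mat2 (int c * (pt_x q s * ?u)) (int c * (pt_x q s * ?v))
     (int c * (pt_y q s * ?u)) (int c * (pt_y q s * ?v))"
    unfolding mat2_mult_def rank_one_def by (simp add: algebra_simps)
  moreover have "int q dvd int c * z \<longleftrightarrow> int q dvd z" for z
    using assms prime_int_q by (simp add: prime_dvd_mult_iff)
  ultimately show ?thesis
    unfolding mat2_null_def image_at_def using dvd_pt_mult_iff[of s] by auto
qed

lemma kernel_at_rank_one_iff:
  assumes "\<not> q dvd c" "t \<le> q" "u \<le> q"
  shows "kernel_at q (rank_one q c s t) u \<longleftrightarrow> u = t"
proof -
  have "kernel_at q (rank_one q c s t) u \<longleftrightarrow>
      int q dvd int c * (pt_x q s * (pt_x q t * pt_y q u - pt_y q t * pt_x q u)) \<and>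
      int q dvd int c * (pt_y q s * (pt_x q t * pt_y q u - pt_y q t * pt_x q u))"
    unfolding kernel_at_def rank_one_def by (simp add: algebra_simps)
  also have "\<dots> \<longleftrightarrow> int q dvd pt_x q t * pt_y q u - pt_y q t * pt_x q u"
    using assms prime_int_q dvd_pt_mult_iff by (simp add: prime_dvd_mult_iff[of "int q" "int c"])
  finally show ?thesis using pt_det_dvd_iff[OF assms(2,3)] by auto
qed

lemma image_at_rank_one_iff:
  assumes "\<not> q dvd c" "s \<le> q" "u \<le> q"
  shows "image_at q (rank_one q c s t) u \<longleftrightarrow> u = s"
proof -
  let ?d = "pt_x q s * pt_y q u - pt_y q s * pt_x q u"
  let ?R = "rank_one q c s t"
  have "m21 ?R * pt_x q u - m11 ?R * pt_y q u = int c * (pt_y q t * ?d)"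
    "m22 ?R * pt_x q u - m12 ?R * pt_y q u = - (int c * (pt_x q t * ?d))"
    by (simp_all add: rank_one_def algebra_simps)
  then have "image_at q ?R u \<longleftrightarrow>
      int q dvd int c * (pt_y q t * ?d) \<and> int q dvd - (int c * (pt_x q t * ?d))"
    unfolding image_at_def by simp
  also have "\<dots> \<longleftrightarrow> int q dvd ?d"
    using assms prime_int_q dvd_pt_mult_iff[of t ?d]
    by (auto simp: prime_dvd_mult_iff[of "int q" "int c"])
  finally show ?thesis using pt_det_dvd_iff[OF assms(2,3)] by auto
qed

lemma rank_one_not_null:
  assumes "\<not> q dvd c" "t \<le> q"
  shows "\<not> mat2_null q (rank_one q c s t)"
proof
  assume "mat2_null q (rank_one q c s t)"
  then have "kernel_at q (rank_one q c s t) u" for u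
    unfolding mat2_null_def kernel_at_def by auto
  then have "0 = t" "q = t" using kernel_at_rank_one_iff[OF assms] by blast+
  then show False using q by simp
qed

lemma mat2_one_not_kernel_at: "\<not> kernel_at q mat2_one t"
  using q_not_dvd_one unfolding kernel_at_def pt_x_def pt_y_def by auto

lemma mat2_one_not_null: "\<not> mat2_null q mat2_one"
  using q_not_dvd_one unfolding mat2_null_def by simp

text \<open>
  Image and kernel determine \<open>s\<close> and \<open>t\<close>; the scalar can then be read off because each spanning
  vector has an entry \<open>1\<close>.
\<close>

lemma rank_one_cong_imp_eq:
  assumes "mat2_cong q (rank_one q c s t) (rank_one q c' s' t')"
    and c: "c \<in> {1..<q}" "c' \<in> {1..<q}" and le: "s \<le> q" "t \<le> q" "s' \<le> q" "t' \<le> q"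
  shows "c = c' \<and> s = s' \<and> t = t'"
proof -
  have nd: "\<not> q dvd c" "\<not> q dvd c'" using c by (auto dest: dvd_imp_le)
  have t: "t = t'"
    using kernel_at_cong[OF assms(1), of t] kernel_at_rank_one_iff nd le by metis
  have s: "s = s'"
    using image_at_cong[OF assms(1), of s] image_at_rank_one_iff nd le by metis
  have "[int c = int c'] (mod int q)"
    using assms(1) unfolding s t mat2_cong_def rank_one_def
    by (cases "s' < q"; cases "t' < q") (auto simp: pt_x_def pt_y_def cong_minus_minus_iff)
  then have "c = c'" using c by (simp add: cong_int_iff cong_def)
  then show ?thesis using s t by simp
qed

end

section \<open>Rings that split into two by two matrix rings\<close>

text \<open>
  The vertices and edges of the zero divisor graph depend only on which products vanish. Hence an
  isomorphism onto \<open>\<Prod>l\<in>I. M\<^sub>2(F\<^sub>p\<^sub>l)\<close> is recorded just by component maps \<open>\<phi> l\<close> that detect vanishing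
  of elements and of products and that are jointly surjective.
\<close>

locale matrix_ring_product =
  fixes H :: "('a, 'm) ring_scheme" (structure)
    and I :: "'i set" and p :: "'i \<Rightarrow> nat" and \<phi> :: "'i \<Rightarrow> 'a \<Rightarrow> mat2"
  assumes finite_I: "finite I"
    and prime_p: "l \<in> I \<Longrightarrow> prime (p l)"
    and p_ge_3: "l \<in> I \<Longrightarrow> 3 \<le> p l"
    and zero_iff: "x \<in> carrier H \<Longrightarrow> x = \<zero> \<longleftrightarrow> (\<forall>l\<in>I. mat2_null (p l) (\<phi> l x))"
    and mult_zero_iff: "x \<in> carrier H \<Longrightarrow> y \<in> carrier H \<Longrightarrow>
      x \<otimes> y = \<zero> \<longleftrightarrow> (\<forall>l\<in>I. mat2_null (p l) (mat2_mult (\<phi> l x) (\<phi> l y)))"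
    and surj: "\<exists>x\<in>carrier H. \<forall>l\<in>I. mat2_cong (p l) (\<phi> l x) (A l)"
begin

text \<open>
  An element with a rank one component at \<open>l\<close> and component \<open>E\<close> elsewhere. The background
  \<open>E = 0\<close> yields the dominating set of the upper bound, and \<open>E = 1\<close> the vertices that are hard to dominate.
\<close>

definition spike :: "'i \<Rightarrow> mat2 \<Rightarrow> nat \<Rightarrow> nat \<Rightarrow> nat \<Rightarrow> 'a" where
  "spike l E c s t = (SOME x. x \<in> carrier H \<and>
     (\<forall>m\<in>I. mat2_cong (p m) (\<phi> m x) (if m = l then rank_one (p l) c s t else E)))"

lemma spike_carrier: "spike l E c s t \<in> carrier H"
  and spike_component: "m \<in> I \<Longrightarrow>
    mat2_cong (p m) (\<phi> m (spike l E c s t)) (if m = l then rank_one (p l) c s t else E)"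
proof -
  have "\<exists>x. x \<in> carrier H \<and>
     (\<forall>m\<in>I. mat2_cong (p m) (\<phi> m x) (if m = l then rank_one (p l) c s t else E))"
    using surj[of "\<lambda>m. if m = l then rank_one (p l) c s t else E"] by blast
  from someI_ex[OF this] show "spike l E c s t \<in> carrier H"
    "m \<in> I \<Longrightarrow> mat2_cong (p m) (\<phi> m (spike l E c s t)) (if m = l then rank_one (p l) c s t else E)"
    unfolding spike_def by blast+
qed

lemma spike_at: "l \<in> I \<Longrightarrow> mat2_cong (p l) (\<phi> l (spike l E c s t)) (rank_one (p l) c s t)"
  using spike_component[of l l] by simp

lemma spike_off: "m \<in> I \<Longrightarrow> m \<noteq> l \<Longrightarrow> mat2_cong (p m) (\<phi> m (spike l E c s t)) E"
  using spike_component[of m l] by simp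

lemma spike_not_null:
  assumes "l \<in> I" "\<not> p l dvd c" "t \<le> p l"
  shows "\<not> mat2_null (p l) (\<phi> l (spike l E c s t))"
  using mat2_null_cong[OF spike_at[OF assms(1)]] rank_one_not_null[OF prime_p[OF assms(1)] assms(2,3)]
  by blast

lemma spike_kernel_at_iff:
  assumes "l \<in> I" "\<not> p l dvd c" "t \<le> p l" "u \<le> p l"
  shows "kernel_at (p l) (\<phi> l (spike l E c s t)) u \<longleftrightarrow> u = t"
  using kernel_at_cong[OF spike_at[OF assms(1)]]
    kernel_at_rank_one_iff[OF prime_p[OF assms(1)] assms(2-4)] by blast

lemma mult_spike_zero_iff:
  assumes l: "l \<in> I" and c: "\<not> p l dvd c" and x: "x \<in> carrier H"
  shows "x \<otimes> spike l E c s t = \<zero> \<longleftrightarrow>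
    kernel_at (p l) (\<phi> l x) s \<and> (\<forall>m\<in>I - {l}. mat2_null (p m) (mat2_mult (\<phi> m x) E))"
proof -
  have 1: "mat2_null (p l) (mat2_mult (\<phi> l x) (\<phi> l (spike l E c s t))) \<longleftrightarrow> kernel_at (p l) (\<phi> l x) s"
    using mat2_null_cong[OF mat2_cong_mult[OF mat2_cong_refl spike_at[OF l]]]
      mult_rank_one_null_iff[OF prime_p[OF l] c] by blast
  have 2: "mat2_null (p m) (mat2_mult (\<phi> m x) (\<phi> m (spike l E c s t))) \<longleftrightarrow>
      mat2_null (p m) (mat2_mult (\<phi> m x) E)" if "m \<in> I - {l}" for m
    using mat2_null_cong[OF mat2_cong_mult[OF mat2_cong_refl spike_off[of m l]]] that by blast
  show ?thesis
    unfolding mult_zero_iff[OF x spike_carrier] using 1 2 l by blast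
qed

lemma spike_mult_zero_iff:
  assumes l: "l \<in> I" and c: "\<not> p l dvd c" and x: "x \<in> carrier H"
  shows "spike l E c s t \<otimes> x = \<zero> \<longleftrightarrow>
    image_at (p l) (\<phi> l x) t \<and> (\<forall>m\<in>I - {l}. mat2_null (p m) (mat2_mult E (\<phi> m x)))"
proof -
  have 1: "mat2_null (p l) (mat2_mult (\<phi> l (spike l E c s t)) (\<phi> l x)) \<longleftrightarrow> image_at (p l) (\<phi> l x) t"
    using mat2_null_cong[OF mat2_cong_mult[OF spike_at[OF l] mat2_cong_refl]]
      rank_one_mult_null_iff[OF prime_p[OF l] c] by blast
  have 2: "mat2_null (p m) (mat2_mult (\<phi> m (spike l E c s t)) (\<phi> m x)) \<longleftrightarrow>
      mat2_null (p m) (mat2_mult E (\<phi> m x))" if "m \<in> I - {l}" for m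
    using mat2_null_cong[OF mat2_cong_mult[OF spike_off[of m l] mat2_cong_refl]] that by blast
  show ?thesis
    unfolding mult_zero_iff[OF spike_carrier x] using 1 2 l by blast
qed

abbreviation \<Gamma> :: "'a pair_pre_digraph" where
  "\<Gamma> \<equiv> undirected_zero_divisor_graph H"

lemma verts_iff: "x \<in> pverts \<Gamma> \<longleftrightarrow> x \<in> carrier H \<and> x \<noteq> \<zero> \<and>
    (\<exists>y\<in>carrier H. y \<noteq> \<zero> \<and> (x \<otimes> y = \<zero> \<or> y \<otimes> x = \<zero>))"
  by (auto simp: undirected_zero_divisor_graph_def zero_divisor_def Let_def)

lemma arcs_iff: "(x, y) \<in> parcs \<Gamma> \<longleftrightarrow> x \<in> pverts \<Gamma> \<and> y \<in> pverts \<Gamma> \<and> x \<noteq> y \<and>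
    (x \<otimes> y = \<zero> \<or> y \<otimes> x = \<zero>)"
  by (auto simp: undirected_zero_divisor_graph_def Let_def)

lemma not_dvd_one: "l \<in> I \<Longrightarrow> \<not> p l dvd 1"
  using prime_p not_prime_unit by blast

lemma spike_nonzero:
  assumes "l \<in> I" "\<not> p l dvd c" "t \<le> p l"
  shows "spike l E c s t \<noteq> \<zero>"
  using spike_not_null[OF assms] zero_iff[OF spike_carrier] assms(1) by blast

lemma spike_vert:
  assumes l: "l \<in> I" and c: "\<not> p l dvd c" and t: "t \<le> p l"
  shows "spike l E c s t \<in> pverts \<Gamma>"
proof -
  let ?y = "spike l mat2_zero 1 t t"
  have "spike l E c s t \<otimes> ?y = \<zero>"
    unfolding mult_spike_zero_iff[OF l not_dvd_one[OF l] spike_carrier]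
      spike_kernel_at_iff[OF l c t t] using mat2_null_mult by (simp add: mat2_null_def)
  moreover have "?y \<noteq> \<zero>" by (rule spike_nonzero[OF l not_dvd_one[OF l] t])
  ultimately show ?thesis
    unfolding verts_iff using spike_nonzero[OF assms] spike_carrier by blast
qed

text \<open>
  If \<open>v\<close> is annihilated by \<open>y \<noteq> 0\<close>, then at a prime where \<open>y\<close> does not vanish \<open>v\<close> kills a line or has
  its image in a line \<open>t\<close>; the element with image and kernel \<open>t\<close> there and \<open>0\<close>
  elsewhere annihilates \<open>v\<close> on the corresponding side.
\<close>

lemma ex_dominating_set:
  "\<exists>D. dominating_set \<Gamma> D \<and> finite D \<and> card D \<le> (\<Sum>l\<in>I. p l + 1)"
proof (intro exI conjI)
  define f where "f l t = spike l mat2_zero 1 t t" for l t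
  let ?D = "\<Union>l\<in>I. f l ` {..p l}"
  show "finite ?D" using finite_I by simp
  have "card ?D \<le> (\<Sum>l\<in>I. card (f l ` {..p l}))"
    by (rule card_UN_le[OF finite_I])
  also have "\<dots> \<le> (\<Sum>l\<in>I. p l + 1)"
    by (intro sum_mono) (metis card_atMost card_image_le finite_atMost Suc_eq_plus1)
  finally show "card ?D \<le> (\<Sum>l\<in>I. p l + 1)" .
  have "f l t \<in> pverts \<Gamma>" if "l \<in> I" "t \<le> p l" for l t
    unfolding f_def using that by (intro spike_vert not_dvd_one)
  then have sub: "?D \<subseteq> pverts \<Gamma>" by (auto simp only: UN_iff image_iff atMost_iff)
  have "\<exists>d\<in>?D. (v, d) \<in> parcs \<Gamma>" if v: "v \<in> pverts \<Gamma> - ?D" for v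
  proof -
    obtain y where vH: "v \<in> carrier H" and y: "y \<in> carrier H" "y \<noteq> \<zero>"
      and vy: "v \<otimes> y = \<zero> \<or> y \<otimes> v = \<zero>"
      using DiffD1[OF v] unfolding verts_iff by blast
    obtain l where l: "l \<in> I" and nn: "\<not> mat2_null (p l) (\<phi> l y)"
      using zero_iff[OF y(1)] y(2) by blast
    have "\<exists>t\<le>p l. kernel_at (p l) (\<phi> l v) t \<or> image_at (p l) (\<phi> l v) t"
      using vy ex_kernel_point[OF prime_p[OF l] _ nn] ex_image_point[OF prime_p[OF l] _ nn] l
      unfolding mult_zero_iff[OF vH y(1)] mult_zero_iff[OF y(1) vH] by blast
    then obtain t where t: "t \<le> p l" and kt: "kernel_at (p l) (\<phi> l v) t \<or> image_at (p l) (\<phi> l v) t"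
      by blast
    have "v \<otimes> f l t = \<zero> \<or> f l t \<otimes> v = \<zero>"
      using kt mat2_null_mult unfolding f_def mult_spike_zero_iff[OF l not_dvd_one[OF l] vH]
        spike_mult_zero_iff[OF l not_dvd_one[OF l] vH] by (auto simp: mat2_null_def)
    moreover have "f l t \<in> ?D" using l t by blast
    moreover have "f l t \<noteq> v" using calculation(2) v by blast
    ultimately have "(v, f l t) \<in> parcs \<Gamma>"
      unfolding arcs_iff using DiffD1[OF v] sub by blast
    then show ?thesis using \<open>f l t \<in> ?D\<close> by blast
  qed
  then show "dominating_set \<Gamma> ?D" using sub unfolding dominating_set_def by blast
qed

text \<open>
  The members of a dominating set that the prime at \<open>l\<close> claims are of two kinds: those that can dominate a
  unit spike of \<open>l\<close>, and unit spikes of \<open>l\<close> that belong to the set themselves.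
\<close>

definition supported_only_at :: "'i \<Rightarrow> 'a \<Rightarrow> bool" where
  "supported_only_at l d \<longleftrightarrow>
     \<not> mat2_null (p l) (\<phi> l d) \<and> (\<forall>m\<in>I - {l}. mat2_null (p m) (\<phi> m d))"

definition unit_spikes :: "'i \<Rightarrow> 'a set" where
  "unit_spikes l = {spike l mat2_one c s t | c s t. c \<in> {1..<p l} \<and> s \<le> p l \<and> t \<le> p l}"

lemma not_dvd_scalar: "c \<in> {1..<q} \<Longrightarrow> \<not> q dvd (c::nat)"
  by (auto dest: dvd_imp_le)

lemma unit_spike_at:
  assumes "l \<in> I" "x \<in> unit_spikes l"
  shows "\<exists>t. kernel_at (p l) (\<phi> l x) t" and "\<not> mat2_null (p l) (\<phi> l x)"
proof -
  obtain c s t where x: "x = spike l mat2_one c s t" and "c \<in> {1..<p l}" and t: "t \<le> p l"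
    using assms(2) unfolding unit_spikes_def by blast
  then have c: "\<not> p l dvd c" by (intro not_dvd_scalar)
  show "\<exists>t. kernel_at (p l) (\<phi> l x) t" "\<not> mat2_null (p l) (\<phi> l x)"
    unfolding x using spike_kernel_at_iff[OF assms(1) c t t] spike_not_null[OF assms(1) c t] by blast+
qed

lemma unit_spike_off:
  assumes "x \<in> unit_spikes l" "m \<in> I" "m \<noteq> l"
  shows "\<not> kernel_at (p m) (\<phi> m x) t" and "\<not> mat2_null (p m) (\<phi> m x)"
proof -
  have "mat2_cong (p m) (\<phi> m x) mat2_one"
    using assms(1) spike_off[OF assms(2,3)] unfolding unit_spikes_def by blast
  then show "\<not> kernel_at (p m) (\<phi> m x) t" "\<not> mat2_null (p m) (\<phi> m x)"
    using kernel_at_cong mat2_null_cong mat2_one_not_kernel_at[OF prime_p[OF assms(2)]]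
      mat2_one_not_null[OF prime_p[OF assms(2)]] by blast+
qed

text \<open>
  An element supported only at \<open>l\<close> vanishes at \<open>m\<close>, where unit spikes of \<open>l\<close> are invertible and unit
  spikes of \<open>m\<close> have rank one; the same holds with \<open>l\<close> and \<open>m\<close> exchanged. So the components at \<open>l\<close>
  and \<open>m\<close> together reveal which of the two primes may claim an element.
\<close>

lemma claimed_members_disjoint:
  assumes "l \<in> I" "m \<in> I" "l \<noteq> m"
  shows "({d. supported_only_at l d} \<union> unit_spikes l) \<inter>
    ({d. supported_only_at m d} \<union> unit_spikes m) = {}"
  using assms unit_spike_at[of l] unit_spike_at[of m] unit_spike_off[of _ l m] unit_spike_off[of _ m l]
  unfolding supported_only_at_def by blast

text \<open>
  An annihilator of a unit spike of \<open>l\<close> must vanish wherever the unit spike is \<open>1\<close>, so if it is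
  nonzero, it is supported exactly at \<open>l\<close>.
\<close>

lemma unit_spike_dominated:
  assumes D: "dominating_set \<Gamma> D" and l: "l \<in> I"
    and c: "c \<in> {1..<p l}" and s: "s \<le> p l" and t: "t \<le> p l"
  shows "spike l mat2_one c s t \<in> D \<or>
    (\<exists>d\<in>D. supported_only_at l d \<and> (kernel_at (p l) (\<phi> l d) s \<or> image_at (p l) (\<phi> l d) t))"
proof (subst disj_commute, rule disjCI)
  let ?x = "spike l mat2_one c s t"
  assume "?x \<notin> D"
  then obtain d where d: "d \<in> D" "(?x, d) \<in> parcs \<Gamma>"
    using D spike_vert[OF l not_dvd_scalar[OF c] t] unfolding dominating_set_def by blast
  then have dH: "d \<in> carrier H" "d \<noteq> \<zero>" and z: "?x \<otimes> d = \<zero> \<or> d \<otimes> ?x = \<zero>"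
    unfolding arcs_iff verts_iff by blast+
  have 1: "(kernel_at (p l) (\<phi> l d) s \<or> image_at (p l) (\<phi> l d) t)"
    and 2: "\<forall>m\<in>I - {l}. mat2_null (p m) (\<phi> m d)"
    using z unfolding mult_spike_zero_iff[OF l not_dvd_scalar[OF c] dH(1)]
      spike_mult_zero_iff[OF l not_dvd_scalar[OF c] dH(1)] mat2_null_mult_one by blast+
  have "\<not> mat2_null (p l) (\<phi> l d)" using 2 dH zero_iff by blast
  then show "\<exists>d\<in>D. supported_only_at l d \<and> (kernel_at (p l) (\<phi> l d) s \<or> image_at (p l) (\<phi> l d) t)"
    using 1 2 d(1) unfolding supported_only_at_def by blast
qed

lemma card_claimed_members_gt:
  assumes D: "dominating_set \<Gamma> D" "finite D" and l: "l \<in> I"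
  shows "p l < card (D \<inter> ({d. supported_only_at l d} \<union> unit_spikes l))"
proof (rule dominators_card_gt[where
      K = "\<lambda>d. {t. t \<le> p l \<and> kernel_at (p l) (\<phi> l d) t}" and
      J = "\<lambda>d. {t. t \<le> p l \<and> image_at (p l) (\<phi> l d) t}" and
      X = "spike l mat2_one"])
  let ?F = "D \<inter> ({d. supported_only_at l d} \<union> unit_spikes l)"
  have nn: "\<not> mat2_null (p l) (\<phi> l d)" if "d \<in> ?F" for d
    using that unit_spike_at[OF l] unfolding supported_only_at_def by blast
  show "finite ?F" using D(2) by simp
  show "3 \<le> p l" by (rule p_ge_3[OF l])
  show "s = t" if "d \<in> ?F" "s \<in> {t. t \<le> p l \<and> kernel_at (p l) (\<phi> l d) t}"
      "t \<in> {t. t \<le> p l \<and> kernel_at (p l) (\<phi> l d) t}" for d s t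
    using kernel_point_unique[OF prime_p[OF l] nn] that by blast
  show "s = t" if "d \<in> ?F" "s \<in> {t. t \<le> p l \<and> image_at (p l) (\<phi> l d) t}"
      "t \<in> {t. t \<le> p l \<and> image_at (p l) (\<phi> l d) t}" for d s t
    using image_point_unique[OF prime_p[OF l] nn] that by blast
  fix c s t assume c: "c \<in> {1..<p l}" and s: "s \<le> p l" and t: "t \<le> p l"
  show "t \<in> {u. u \<le> p l \<and> kernel_at (p l) (\<phi> l (spike l mat2_one c s t)) u}"
    using spike_kernel_at_iff[OF l not_dvd_scalar[OF c] t t] t by blast
  show "spike l mat2_one c s t \<in> ?F \<or> (\<exists>d\<in>?F. s \<in> {t. t \<le> p l \<and> kernel_at (p l) (\<phi> l d) t} \<or>
      t \<in> {t. t \<le> p l \<and> image_at (p l) (\<phi> l d) t})"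
    using unit_spike_dominated[OF D(1) l c s t] c s t unfolding unit_spikes_def by blast
  fix c' s' t' assume *: "c' \<in> {1..<p l}" "s' \<le> p l" "t' \<le> p l"
    "spike l mat2_one c s t = spike l mat2_one c' s' t'"
  then have "mat2_cong (p l) (rank_one (p l) c s t) (rank_one (p l) c' s' t')"
    using spike_at[OF l] mat2_cong_sym mat2_cong_trans by metis
  from rank_one_cong_imp_eq[OF prime_p[OF l] this c *(1) s t *(2,3)]
  show "c = c' \<and> s = s'" by blast
qed

text \<open>
  Each \<open>l\<close> claims more than \<open>p l\<close> members of \<open>D\<close>, and by \<open>claimed_members_disjoint\<close> no member is claimed
  twice.
\<close>

lemma dominating_set_card_ge:
  assumes D: "dominating_set \<Gamma> D" "finite D"
  shows "(\<Sum>l\<in>I. p l + 1) \<le> card D"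
proof -
  let ?F = "\<lambda>l. D \<inter> ({d. supported_only_at l d} \<union> unit_spikes l)"
  have "(\<Sum>l\<in>I. p l + 1) \<le> (\<Sum>l\<in>I. card (?F l))"
    using card_claimed_members_gt[OF D] by (intro sum_mono) (simp add: Suc_le_eq)
  also have "\<dots> = card (\<Union>l\<in>I. ?F l)"
    using claimed_members_disjoint D(2) by (intro card_UN_disjoint[symmetric] finite_I) blast+
  also have "\<dots> \<le> card D"
    using D(2) by (intro card_mono) auto
  finally show ?thesis .
qed

theorem domination_number_eq: "domination_number \<Gamma> = (\<Sum>l\<in>I. p l + 1)"
  unfolding domination_number_def
proof (rule Least_equality)
  show "\<exists>D. dominating_set \<Gamma> D \<and> finite D \<and> card D = (\<Sum>l\<in>I. p l + 1)"
    using ex_dominating_set dominating_set_card_ge le_antisym by blast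
qed (use dominating_set_card_ge in blast)

end

section \<open>Splitting the quaternions modulo a product of odd primes\<close>

text \<open>
  The pigeonhole argument: there are \<open>(q + 1) / 2\<close> squares modulo \<open>q\<close>, hence also \<open>(q + 1) / 2\<close> values
  \<open>- 1 - y\<^sup>2\<close>, and two sets of this size among \<open>q\<close> residues must meet.
\<close>

lemma ex_sum_two_squares_cong_minus_one:
  fixes q :: nat
  assumes "prime q" "odd q"
  shows "\<exists>a b :: int. int q dvd a * a + b * b + 1"
proof -
  define m where "m = (int q - 1) div 2"
  have q: "int q = 2 * m + 1" using assms(2) unfolding m_def by (auto elim!: oddE)
  have m0: "0 \<le> m" using q by simp
  have pq: "prime (int q)" using assms(1) by simp
  have inj: "x = y" if "int q dvd x * x - y * y" "x \<in> {0..m}" "y \<in> {0..m}" for x y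
  proof -
    have "int q dvd (x - y) * (x + y)" using that(1) by (simp add: algebra_simps)
    then have "int q dvd x - y \<or> int q dvd x + y" using pq by (simp add: prime_dvd_mult_iff)
    moreover have "\<bar>x - y\<bar> < int q" "\<bar>x + y\<bar> < int q" using that(2,3) q by auto
    ultimately have "x - y = 0 \<or> x + y = 0"
      by (metis abs_of_nat dvd_imp_le_int not_le)
    then show ?thesis using that(2,3) by auto
  qed
  let ?f = "\<lambda>x. (x * x) mod int q" and ?g = "\<lambda>y. (- 1 - y * y) mod int q"
  have f: "inj_on ?f {0..m}"
    by (intro inj_onI inj) (auto simp: mod_eq_dvd_iff)
  have g: "inj_on ?g {0..m}"
  proof (intro inj_onI)
    fix x y assume xy: "x \<in> {0..m}" "y \<in> {0..m}" "?g x = ?g y"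
    then have "int q dvd y * y - x * x" by (simp add: mod_eq_dvd_iff)
    then show "x = y" using inj xy by metis
  qed
  have "?f ` {0..m} \<inter> ?g ` {0..m} \<noteq> {}"
  proof
    assume "?f ` {0..m} \<inter> ?g ` {0..m} = {}"
    then have "card (?f ` {0..m} \<union> ?g ` {0..m}) = 2 * nat (m + 1)"
      using m0 by (simp add: card_Un_disjoint card_image[OF f] card_image[OF g])
    moreover have "card (?f ` {0..m} \<union> ?g ` {0..m}) \<le> card {0..<int q}"
      using prime_gt_0_int[OF pq] by (intro card_mono) auto
    ultimately show False using q m0 by simp
  qed
  then obtain x y where "?f x = ?g y" by auto
  then have "int q dvd x * x + y * y + 1" by (simp add: mod_eq_dvd_iff algebra_simps)
  then show ?thesis by blast
qed

text \<open>
  The linear map with \<open>i \<mapsto> (0, -1; 1, 0)\<close>, \<open>j \<mapsto> (a, b; b, -a)\<close> and \<open>k \<mapsto> (-b, a; a, b)\<close>, the product of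
  the former two. Both \<open>j\<close> and \<open>k\<close> go to matrices with square \<open>a\<^sup>2 + b\<^sup>2\<close>, so the map is
  multiplicative modulo \<open>q\<close> as soon as \<open>a\<^sup>2 + b\<^sup>2 = -1\<close> there.
\<close>

definition quat_mat :: "int \<Rightarrow> int \<Rightarrow> int quaternion \<Rightarrow> mat2" where
  "quat_mat a b x = Mat2
     (re x + a * im_j x - b * im_k x) (- im_i x + b * im_j x + a * im_k x)
     (im_i x + b * im_j x + a * im_k x) (re x - a * im_j x + b * im_k x)"

lemma quat_mat_cong:
  assumes "[re x = re y] (mod int q)" "[im_i x = im_i y] (mod int q)"
    "[im_j x = im_j y] (mod int q)" "[im_k x = im_k y] (mod int q)"
  shows "mat2_cong q (quat_mat a b x) (quat_mat a b y)"
proof -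
  have "[- im_i x = - im_i y] (mod int q)"
    using assms(2) by (simp add: cong_minus_minus_iff)
  then show ?thesis
    unfolding mat2_cong_def quat_mat_def mat2.sel
    by (intro conjI cong_add cong_diff cong_scalar_left assms)
qed

lemma quat_mat_mult:
  fixes x y :: "int quaternion"
  assumes w: "int q dvd a * a + b * b + 1"
  shows "mat2_cong q (quat_mat a b (Quat
      (re x * re y - im_i x * im_i y - im_j x * im_j y - im_k x * im_k y)
      (re x * im_i y + im_i x * re y + im_j x * im_k y - im_k x * im_j y)
      (re x * im_j y + im_j x * re y + im_k x * im_i y - im_i x * im_k y)
      (re x * im_k y + im_k x * re y + im_i x * im_j y - im_j x * im_i y)))
    (mat2_mult (quat_mat a b x) (quat_mat a b y))" (is "mat2_cong q ?P ?Q")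
proof -
  let ?w = "a * a + b * b + 1"
  \<comment> \<open>Over the integers, the defect of multiplicativity is a multiple of \<open>?w\<close>.\<close>
  have "m11 ?P - m11 ?Q = ?w * - (im_j x * im_j y + im_k x * im_k y)"
    "m12 ?P - m12 ?Q = ?w * (im_k x * im_j y - im_j x * im_k y)"
    "m21 ?P - m21 ?Q = ?w * (im_j x * im_k y - im_k x * im_j y)"
    "m22 ?P - m22 ?Q = ?w * - (im_j x * im_j y + im_k x * im_k y)"
    by (simp_all add: quat_mat_def mat2_mult_def algebra_simps)
  then show ?thesis
    unfolding mat2_cong_def cong_iff_dvd_diff using w by (simp only: dvd_mult2)
qed

text \<open>
  Twice each coefficient is a combination of the matrix entries, up to multiples of
  \<open>a\<^sup>2 + b\<^sup>2 + 1\<close>; for odd \<open>q\<close> the map is therefore injective modulo \<open>q\<close>. The same inverse formulas,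
  with \<open>2\<close> inverted, prove surjectivity in \<open>quat_mat_surj\<close>.
\<close>

lemma quat_mat_null_imp:
  assumes q: "prime q" "odd q" and w: "int q dvd a * a + b * b + 1"
    and null: "mat2_null q (quat_mat a b x)"
  shows "int q dvd re x \<and> int q dvd im_i x \<and> int q dvd im_j x \<and> int q dvd im_k x"
proof -
  let ?w = "a * a + b * b + 1" and ?M = "quat_mat a b x"
  have eqs: "2 * re x = m11 ?M + m22 ?M" "2 * im_i x = m21 ?M - m12 ?M"
    "2 * im_j x = ?w * (2 * im_j x) - (a * (m11 ?M - m22 ?M) + b * (m12 ?M + m21 ?M))"
    "2 * im_k x = ?w * (2 * im_k x) - (a * (m12 ?M + m21 ?M) - b * (m11 ?M - m22 ?M))"
    by (simp_all add: quat_mat_def algebra_simps)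
  have M: "int q dvd m11 ?M" "int q dvd m12 ?M" "int q dvd m21 ?M" "int q dvd m22 ?M"
    using null unfolding mat2_null_def by blast+
  have "int q dvd 2 * re x" "int q dvd 2 * im_i x"
    unfolding eqs(1,2) by (intro dvd_add dvd_diff M)+
  moreover have "int q dvd 2 * im_j x" "int q dvd 2 * im_k x"
    by (subst eqs(3), intro dvd_diff dvd_add dvd_mult dvd_mult2[OF w] M)
      (subst eqs(4), intro dvd_diff dvd_add dvd_mult dvd_mult2[OF w] M)
  moreover have "coprime (int q) 2" using q(2) by simp
  ultimately show ?thesis by (simp add: coprime_dvd_mult_right_iff)
qed

lemma quat_mat_surj:
  assumes "odd q" and w: "int q dvd a * a + b * b + 1"
  shows "\<exists>x. mat2_cong q (quat_mat a b x) A"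
proof -
  \<comment> \<open>The inverse of 2 modulo \<open>q\<close>.\<close>
  define h where "h = (int q + 1) div 2"
  have h: "2 * h = int q + 1" using assms(1) unfolding h_def by (auto elim!: oddE)
  let ?w = "a * a + b * b + 1" and ?u = "m11 A - m22 A" and ?v = "m12 A + m21 A"
  let ?x = "Quat (h * (m11 A + m22 A)) (h * (m21 A - m12 A))
    (- h * (a * ?u + b * ?v)) (h * (b * ?u - a * ?v))"
  let ?M = "quat_mat a b ?x"
  have "m11 ?M - m11 A = (2 * h - 1) * m11 A - ?w * (h * ?u)"
    "m12 ?M - m12 A = (2 * h - 1) * m12 A - ?w * (h * ?v)"
    "m21 ?M - m21 A = (2 * h - 1) * m21 A - ?w * (h * ?v)"
    "m22 ?M - m22 A = (2 * h - 1) * m22 A + ?w * (h * ?u)"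
    by (simp_all add: quat_mat_def algebra_simps)
  moreover have "int q dvd 2 * h - 1" by (simp add: h)
  ultimately have "mat2_cong q ?M A"
    unfolding mat2_cong_def cong_iff_dvd_diff using w by (simp only: dvd_mult2 dvd_diff dvd_add)
  then show ?thesis by blast
qed

lemma int_chinese_remainder:
  fixes m :: "'i \<Rightarrow> nat" and u :: "'i \<Rightarrow> int"
  assumes "finite A" "\<forall>i\<in>A. m i \<noteq> 0" "\<forall>i\<in>A. \<forall>j\<in>A. i \<noteq> j \<longrightarrow> coprime (m i) (m j)"
  shows "\<exists>x\<in>{0..int (\<Prod>i\<in>A. m i) - 1}. \<forall>i\<in>A. [x = u i] (mod int (m i))"
proof -
  obtain x where x: "x < (\<Prod>i\<in>A. m i)" "\<forall>i\<in>A. [x = nat (u i mod int (m i))] (mod m i)"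
    using chinese_remainder_unique_nat[OF assms, of "\<lambda>i. nat (u i mod int (m i))"] by blast
  have "[int x = u i] (mod int (m i))" if i: "i \<in> A" for i
  proof -
    have "[int x = int (nat (u i mod int (m i)))] (mod int (m i))"
      using x(2) i by (simp only: cong_int_iff)
    then show ?thesis using assms(2) i by (simp add: cong_def)
  qed
  moreover have "int x \<in> {0..int (\<Prod>i\<in>A. m i) - 1}"
    using x(1) by (simp del: of_nat_prod)
  ultimately show ?thesis by blast
qed

text \<open>
  Each prime has its own \<open>a l\<close> and \<open>b l\<close>. Joint surjectivity comes from the Chinese remainder theorem,
  applied to the four coefficients separately.
\<close>

lemma lipschitz_quaternions_split:
  fixes I :: "'i set" and p :: "'i \<Rightarrow> nat" and a b :: "'i \<Rightarrow> int"
  assumes fin: "finite I" and ne: "I \<noteq> {}" and pr: "\<And>l. l \<in> I \<Longrightarrow> prime (p l)"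
    and odd: "\<And>l. l \<in> I \<Longrightarrow> odd (p l)" and inj: "inj_on p I"
    and ab: "\<And>l. l \<in> I \<Longrightarrow> int (p l) dvd a l * a l + b l * b l + 1"
  shows "matrix_ring_product (lipschitz_quaternions_mod (\<Prod>l\<in>I. p l)) I p
    (\<lambda>l. quat_mat (a l) (b l))"
proof -
  define n where "n = (\<Prod>l\<in>I. p l)"
  let ?H = "lipschitz_quaternions_mod n"
  have cop: "coprime (p l) (p m)" if "l \<in> I" "m \<in> I" "l \<noteq> m" for l m
    using that pr inj primes_coprime by (metis inj_onD)
  have p_dvd: "p l dvd n" if "l \<in> I" for l
    unfolding n_def using fin that by (rule dvd_prodI)
  have p_gt: "1 < p l" if "l \<in> I" for l using pr[OF that] prime_gt_1_nat by blast
  have "0 < n" unfolding n_def using p_gt by (intro prod_pos) (metis gr_zeroI not_less_zero)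
  then have n1: "1 < int n"
    using ne p_gt p_dvd dvd_imp_le by (metis equals0I le_trans not_le of_nat_1 of_nat_less_iff)
  interpret R: residues "int n" "residue_ring (int n)"
    by unfold_locales (use n1 in simp_all)
  interpret H: ring ?H
    unfolding lipschitz_quaternions_mod_def by (rule R.quaternion_ring_is_ring)
  have carrier: "x \<in> carrier ?H \<longleftrightarrow> re x \<in> {0..int n - 1} \<and> im_i x \<in> {0..int n - 1} \<and>
      im_j x \<in> {0..int n - 1} \<and> im_k x \<in> {0..int n - 1}" for x
    by (cases x) (auto simp: lipschitz_quaternions_mod_def quaternion_ring_def R.res_carrier_eq)
  have zero: "\<zero>\<^bsub>?H\<^esub> = Quat 0 0 0 0"
    by (simp add: lipschitz_quaternions_mod_def quaternion_ring_def R.res_zero_eq)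
  have coord_zero: "z = 0" if "z \<in> {0..int n - 1}" "\<And>l. l \<in> I \<Longrightarrow> int (p l) dvd z" for z
  proof -
    have "[z = 0] (mod (\<Prod>l\<in>I. int (p l)))"
      using that(2) cop by (intro cong_cong_prod_coprime) (auto simp: cong_0_iff)
    then have "int n dvd z" unfolding n_def by (simp add: cong_0_iff)
    moreover have "\<bar>z\<bar> < int n" using that(1) by auto
    ultimately show ?thesis by (metis abs_of_nat dvd_imp_le_int not_le)
  qed
  have zero_iff: "x = \<zero>\<^bsub>?H\<^esub> \<longleftrightarrow> (\<forall>l\<in>I. mat2_null (p l) (quat_mat (a l) (b l) x))"
    if x: "x \<in> carrier ?H" for x
  proof
    assume "x = \<zero>\<^bsub>?H\<^esub>"
    then show "\<forall>l\<in>I. mat2_null (p l) (quat_mat (a l) (b l) x)"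
      by (simp add: zero mat2_null_def quat_mat_def)
  next
    assume null: "\<forall>l\<in>I. mat2_null (p l) (quat_mat (a l) (b l) x)"
    have "int (p l) dvd re x \<and> int (p l) dvd im_i x \<and> int (p l) dvd im_j x \<and> int (p l) dvd im_k x"
      if "l \<in> I" for l
      using quat_mat_null_imp[OF pr odd ab] null that by blast
    then show "x = \<zero>\<^bsub>?H\<^esub>"
      using x coord_zero unfolding zero carrier by (intro quaternion.expand) simp
  qed
  have mult: "mat2_cong (p l) (quat_mat (a l) (b l) (x \<otimes>\<^bsub>?H\<^esub> y))
      (mat2_mult (quat_mat (a l) (b l) x) (quat_mat (a l) (b l) y))" if l: "l \<in> I" for l x y
  proof (rule mat2_cong_trans[OF quat_mat_cong quat_mat_mult[OF ab[OF l]]])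
    have "int (p l) dvd int n" using p_dvd[OF l] by simp
    then have red: "[z mod int n = z] (mod int (p l))" for z
      by (simp add: cong_def mod_mod_cancel)
    let ?xy = "x \<otimes>\<^bsub>?H\<^esub> y"
    have "re ?xy = (re x * re y - im_i x * im_i y - im_j x * im_j y - im_k x * im_k y) mod int n"
      "im_i ?xy = (re x * im_i y + im_i x * re y + im_j x * im_k y - im_k x * im_j y) mod int n"
      "im_j ?xy = (re x * im_j y + im_j x * re y + im_k x * im_i y - im_i x * im_k y) mod int n"
      "im_k ?xy = (re x * im_k y + im_k x * re y + im_i x * im_j y - im_j x * im_i y) mod int n"
      by (simp_all add: lipschitz_quaternions_mod_def quaternion_ring_def a_minus_def
          R.res_add_eq R.res_mult_eq R.res_neg_eq mod_simps)
    then show "[re ?xy = re (Quat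
        (re x * re y - im_i x * im_i y - im_j x * im_j y - im_k x * im_k y)
        (re x * im_i y + im_i x * re y + im_j x * im_k y - im_k x * im_j y)
        (re x * im_j y + im_j x * re y + im_k x * im_i y - im_i x * im_k y)
        (re x * im_k y + im_k x * re y + im_i x * im_j y - im_j x * im_i y))] (mod int (p l))"
      "[im_i ?xy = im_i (Quat
        (re x * re y - im_i x * im_i y - im_j x * im_j y - im_k x * im_k y)
        (re x * im_i y + im_i x * re y + im_j x * im_k y - im_k x * im_j y)
        (re x * im_j y + im_j x * re y + im_k x * im_i y - im_i x * im_k y)
        (re x * im_k y + im_k x * re y + im_i x * im_j y - im_j x * im_i y))] (mod int (p l))"
      "[im_j ?xy = im_j (Quat
        (re x * re y - im_i x * im_i y - im_j x * im_j y - im_k x * im_k y)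
        (re x * im_i y + im_i x * re y + im_j x * im_k y - im_k x * im_j y)
        (re x * im_j y + im_j x * re y + im_k x * im_i y - im_i x * im_k y)
        (re x * im_k y + im_k x * re y + im_i x * im_j y - im_j x * im_i y))] (mod int (p l))"
      "[im_k ?xy = im_k (Quat
        (re x * re y - im_i x * im_i y - im_j x * im_j y - im_k x * im_k y)
        (re x * im_i y + im_i x * re y + im_j x * im_k y - im_k x * im_j y)
        (re x * im_j y + im_j x * re y + im_k x * im_i y - im_i x * im_k y)
        (re x * im_k y + im_k x * re y + im_i x * im_j y - im_j x * im_i y))] (mod int (p l))"
      using red by simp_all
  qed
  have "matrix_ring_product ?H I p (\<lambda>l. quat_mat (a l) (b l))"
  proof
    show "finite I" by (rule fin)
    show "prime (p l)" if "l \<in> I" for l by (rule pr[OF that])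
    show "3 \<le> p l" if "l \<in> I" for l
      using p_gt[OF that] odd[OF that] by (cases "p l = 2") auto
    show "x = \<zero>\<^bsub>?H\<^esub> \<longleftrightarrow> (\<forall>l\<in>I. mat2_null (p l) (quat_mat (a l) (b l) x))"
      if "x \<in> carrier ?H" for x by (rule zero_iff[OF that])
    show "x \<otimes>\<^bsub>?H\<^esub> y = \<zero>\<^bsub>?H\<^esub> \<longleftrightarrow>
        (\<forall>l\<in>I. mat2_null (p l) (mat2_mult (quat_mat (a l) (b l) x) (quat_mat (a l) (b l) y)))"
      if "x \<in> carrier ?H" "y \<in> carrier ?H" for x y
      using zero_iff[OF H.m_closed[OF that]] mat2_null_cong[OF mult] by blast
    show "\<exists>x\<in>carrier ?H. \<forall>l\<in>I. mat2_cong (p l) (quat_mat (a l) (b l) x) (A l)" for A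
    proof -
      have "\<forall>l\<in>I. \<exists>x. mat2_cong (p l) (quat_mat (a l) (b l) x) (A l)"
        using quat_mat_surj[OF odd ab] by blast
      then obtain c where c: "\<forall>l\<in>I. mat2_cong (p l) (quat_mat (a l) (b l) (c l)) (A l)"
        by metis
      have crt: "\<exists>z\<in>{0..int n - 1}. \<forall>l\<in>I. [z = u l] (mod int (p l))" for u
        unfolding n_def using cop p_gt by (intro int_chinese_remainder fin) force+
      obtain r where r: "r \<in> {0..int n - 1}" "\<forall>l\<in>I. [r = re (c l)] (mod int (p l))"
        using crt[of "\<lambda>l. re (c l)"] by blast
      obtain i where i: "i \<in> {0..int n - 1}" "\<forall>l\<in>I. [i = im_i (c l)] (mod int (p l))"
        using crt[of "\<lambda>l. im_i (c l)"] by blast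
      obtain j where j: "j \<in> {0..int n - 1}" "\<forall>l\<in>I. [j = im_j (c l)] (mod int (p l))"
        using crt[of "\<lambda>l. im_j (c l)"] by blast
      obtain k where k: "k \<in> {0..int n - 1}" "\<forall>l\<in>I. [k = im_k (c l)] (mod int (p l))"
        using crt[of "\<lambda>l. im_k (c l)"] by blast
      have "mat2_cong (p l) (quat_mat (a l) (b l) (Quat r i j k)) (A l)" if "l \<in> I" for l
      proof (rule mat2_cong_trans)
        show "mat2_cong (p l) (quat_mat (a l) (b l) (Quat r i j k)) (quat_mat (a l) (b l) (c l))"
          using r(2) i(2) j(2) k(2) that by (intro quat_mat_cong) auto
        show "mat2_cong (p l) (quat_mat (a l) (b l) (c l)) (A l)" using c that by blast
      qed
      then show ?thesis
        using r(1) i(1) j(1) k(1) by (intro bexI[of _ "Quat r i j k"]) (auto simp: carrier)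
    qed
  qed
  then show ?thesis unfolding n_def .
qed

theorem theorem13:
  fixes k n :: nat and p :: "nat \<Rightarrow> nat"
  assumes "k \<ge> 1"
    and "\<And>l. l \<in> {1..k} \<Longrightarrow> prime (p l) \<and> odd (p l)"
    and "inj_on p {1..k}"
    and "n = (\<Prod>l=1..k. p l)"
  shows "domination_number (undirected_zero_divisor_graph (lipschitz_quaternions_mod n))
    = k + (\<Sum>l=1..k. p l)"
proof -
  have "\<forall>l\<in>{1..k}. \<exists>a b :: int. int (p l) dvd a * a + b * b + 1"
    using ex_sum_two_squares_cong_minus_one assms(2) by blast
  then obtain a b :: "nat \<Rightarrow> int" where ab: "\<forall>l\<in>{1..k}. int (p l) dvd a l * a l + b l * b l + 1"
    by metis
  have "matrix_ring_product (lipschitz_quaternions_mod (\<Prod>l=1..k. p l)) {1..k} p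
      (\<lambda>l. quat_mat (a l) (b l))"
    using assms ab by (intro lipschitz_quaternions_split) auto
  from matrix_ring_product.domination_number_eq[OF this]
  show ?thesis by (simp add: assms(4) sum_Suc)
qed

end
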